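(* Let $G=(V,E)$ be a simple undirected graph, $S\subseteq\binom{V}{2}$, let $a^{\mathsf T}x\geq b$ be facet-defining for $\mathrm{MultC}(G,S)$, and let $f\in E$. Obtain $\overline G=(\overline V,\overline E)$ from $G$ by subdividing $f$ into two edges $f_1,f_2$ (via a new node). Then $$a_f(x_{f_1}+x_{f_2})+\sum_{e\in E\setminus\{f\}}a_ex_e\geq b$$ is facet-defining for $\mathrm{MultC}(\overline G,S)$. In particular, if $a^{\mathsf T}x\geq b$ defines a shared facet of $\mathrm{MultC}(G,S)$, then so does this inequality for $\mathrm{MultC}(\overline G,S)$.
   Context: Given a graph $G=(V,E)$ and $S\subseteq\binom{V}{2}$, an ($S$-)multicut is a set $\delta\subseteq E$ such that for every $\{s,t\}\in S$ the nodes $s$ and $t$ lie in different components of $G-\delta$. For $F\subseteq E$, $x^F\in\mathbb{R}^E$ is its incidence vector. The multicut polytope is $\mathrm{MultC}^{\square}(G,S)=\mathrm{conv}\{x^\delta:\delta\text{ an } S\text{-multicut}\}$ and the multicut dominant is $\mathrm{MultC}(G,S)=\mathrm{MultC}^{\square}(G,S)+\mathbb{R}^E_{\geq 0}$. A facet-defining inequality of $\mathrm{MultC}(G,S)$ defines a shared facet if it is also facet-defining for $\mathrm{MultC}^{\square}(G,S)$.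
   Formalization: The formal theorem additionally assumes that the inequality is not a positive multiple of x_f ≥ 0 for the subdivided edge f; in that case the claim fails, since x_{f1}+x_{f2} ≥ 0 is tight only where both coordinates vanish, a face of codimension at least 2. *)

theory Defs
  imports "HOL-Analysis.Analysis"
begin

text \<open>
  Nodes come from a finite type, which may be larger than the node set \<open>V\<close>; an undirected edge is
  the set of its two end nodes. For \<open>E\<close> a set of edges, \<open>\<real>\<^sup>E\<close> is represented by the coordinate
  subspace of \<open>real ^ ('v set)\<close> of all vectors that vanish outside \<open>E\<close>.
\<close>

definition node_pairs :: "'v set \<Rightarrow> 'v set set" where
  "node_pairs V = {e. e \<subseteq> V \<and> card e = 2}"

definition simple_graph :: "'v set \<Rightarrow> 'v set set \<Rightarrow> bool" where
  "simple_graph V E \<longleftrightarrow> finite V \<and> E \<subseteq> node_pairs V"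

definition component :: "'v set \<Rightarrow> 'v set set \<Rightarrow> 'v \<Rightarrow> 'v set" where
  "component V E v = {u \<in> V. (v, u) \<in> {(x, y). {x, y} \<in> E}\<^sup>*}"

definition multicut :: "'v set \<Rightarrow> 'v set set \<Rightarrow> 'v set set \<Rightarrow> 'v set set \<Rightarrow> bool" where
  "multicut V E S \<delta> \<longleftrightarrow>
     \<delta> \<subseteq> E \<and> (\<forall>s t. {s, t} \<in> S \<longrightarrow> component V (E - \<delta>) s \<noteq> component V (E - \<delta>) t)"

definition incidence_vector :: "'v::finite set set \<Rightarrow> real ^ ('v set)" where
  "incidence_vector F = (\<chi> e. if e \<in> F then 1 else 0)"

definition nonneg_orthant :: "'v::finite set set \<Rightarrow> (real ^ ('v set)) set" where
  "nonneg_orthant E = {y. (\<forall>e\<in>E. 0 \<le> y $ e) \<and> (\<forall>e. e \<notin> E \<longrightarrow> y $ e = 0)}"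

definition multicut_polytope ::
    "'v::finite set \<Rightarrow> 'v set set \<Rightarrow> 'v set set \<Rightarrow> (real ^ ('v set)) set" where
  "multicut_polytope V E S = convex hull {incidence_vector \<delta> |\<delta>. multicut V E S \<delta>}"

definition multicut_dominant ::
    "'v::finite set \<Rightarrow> 'v set set \<Rightarrow> 'v set set \<Rightarrow> (real ^ ('v set)) set" where
  "multicut_dominant V E S =
     {x + y |x y. x \<in> multicut_polytope V E S \<and> y \<in> nonneg_orthant E}"

text \<open>
  An inequality \<open>l x \<ge> b\<close> is given by the linear form \<open>l\<close> and the right-hand side \<open>b\<close>.
  The dimensions in \<open>facet_of\<close> are affine dimensions, so \<open>P\<close> need not be full-dimensional.
\<close>

definition facet_defining :: "'a::euclidean_space set \<Rightarrow> ('a \<Rightarrow> real) \<Rightarrow> real \<Rightarrow> bool" where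
  "facet_defining P l b \<longleftrightarrow>
     linear l \<and> (\<forall>x\<in>P. l x \<ge> b) \<and> {x \<in> P. l x = b} facet_of P"

definition shared_facet_defining ::
    "'v::finite set \<Rightarrow> 'v set set \<Rightarrow> 'v set set \<Rightarrow> (real ^ ('v set) \<Rightarrow> real) \<Rightarrow> real \<Rightarrow> bool" where
  "shared_facet_defining V E S l b \<longleftrightarrow>
     facet_defining (multicut_dominant V E S) l b \<and> facet_defining (multicut_polytope V E S) l b"

end

theory Submission
  imports Defs
begin

text \<open>
  Renaming the coordinate \<open>f\<close> to \<open>f\<^sub>1\<close> or to \<open>f\<^sub>2\<close> embeds the facet into the new face. The first copy
  lies in \<open>x\<^sub>f\<^sub>2 = 0\<close>, so one point with \<open>x\<^sub>f \<noteq> 0\<close> in the second copy raises the dimension by one;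
  such a point exists unless the facet is \<open>x\<^sub>f \<ge> 0\<close>. For the dominant, of dimension \<open>|E|\<close>, this
  suffices. The polytope has dimension \<open>|E - S|\<close>, which grows by two if \<open>f \<in> S\<close>. In that case a
  shared facet has \<open>a\<^sub>f = 0\<close>, since otherwise it is \<open>x\<^sub>f \<ge> 1\<close>, which is an equation on the polytope;
  hence \<open>f\<^sub>1\<close> can be added to the multicuts of a tight point with \<open>x\<^sub>f\<^sub>1 + x\<^sub>f\<^sub>2 = 1\<close>, and this leaves
  the affine hull of the two copies.
\<close>

section \<open>Coordinate subspaces, coordinate maps and affine dimension\<close>

definition coord_space :: "'i set \<Rightarrow> (real ^ 'i::finite) set" where
  "coord_space A = {x. \<forall>i. i \<notin> A \<longrightarrow> x $ i = 0}"

text \<open>A swap, unlike a renaming, is injective on the whole space and so preserves affine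
  dimension. On vectors that vanish at \<open>j\<close> it acts as renaming coordinate
  \<open>i\<close> to \<open>j\<close>.\<close>

definition swap_coord :: "'i \<Rightarrow> 'i \<Rightarrow> real ^ 'i \<Rightarrow> real ^ 'i::finite" where
  "swap_coord i j x = (\<chi> k. x $ Transposition.transpose i j k)"

text \<open>On incidence vectors this inserts \<open>i\<close> into the set. The map is affine but
  not linear.\<close>

definition raise_coord :: "'i \<Rightarrow> real ^ 'i \<Rightarrow> real ^ 'i::finite" where
  "raise_coord i x = (\<chi> k. if k = i then 1 else x $ k)"

abbreviation adj :: "'v set set \<Rightarrow> ('v \<times> 'v) set" where
  "adj E \<equiv> {(x, y). {x, y} \<in> E}"

lemma subspace_coord_space: "subspace (coord_space A)"
  by (auto simp: coord_space_def subspace_def)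

lemma dim_coord_space: "dim (coord_space A) = card A"
  unfolding coord_space_def dim_vec_eq[symmetric] by (rule dim_substandard_cart)

lemma aff_dim_coord_space: "aff_dim (coord_space A) = int (card A)"
  by (simp add: aff_dim_subspace subspace_coord_space dim_coord_space)

lemma coord_space_subset_subspace:
  assumes "subspace T" "\<And>i. i \<in> A \<Longrightarrow> axis i 1 \<in> T"
  shows "coord_space A \<subseteq> T"
proof
  fix x assume x: "x \<in> coord_space A"
  have "(\<Sum>i\<in>A. x $ i *\<^sub>R axis i 1) \<in> T"
    using assms by (intro subspace_sum subspace_mul) auto
  moreover have "(\<Sum>i\<in>A. x $ i *\<^sub>R axis i 1) = x"
    using x by (auto simp: vec_eq_iff coord_space_def axis_def if_distrib sum.delta cong: if_cong)
  ultimately show "x \<in> T" by simp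
qed

text \<open>Translation by \<open>- p\<close> puts \<open>P\<close> inside
  \<open>coord_space A\<close> together with a nonzero multiple of each axis vector of
  \<open>A\<close>, so the translate spans that subspace. For both polyhedra below, \<open>p\<close>
  is the incidence vector of the full edge set.\<close>

lemma aff_dim_eq_card_coords:
  fixes A :: "'i::finite set"
  assumes "p \<in> P" and sub: "\<And>x. x \<in> P \<Longrightarrow> x - p \<in> coord_space A"
    and "\<And>i. i \<in> A \<Longrightarrow> \<exists>c. c \<noteq> 0 \<and> p + c *\<^sub>R axis i 1 \<in> P"
  shows "aff_dim P = int (card A)"
proof -
  have eq: "aff_dim P = int (dim ((+) (- p) ` P))"
    using assms(1) by (intro aff_dim_eq_dim hull_inc)
  have "coord_space A \<subseteq> span ((+) (- p) ` P)"
  proof (rule coord_space_subset_subspace[OF subspace_span])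
    fix i assume "i \<in> A"
    then obtain c where c: "c \<noteq> 0" "p + c *\<^sub>R axis i 1 \<in> P" using assms(3) by blast
    then have "c *\<^sub>R axis i 1 \<in> span ((+) (- p) ` P)"
      by (intro span_base) (auto simp: image_iff intro!: bexI[of _ "p + c *\<^sub>R axis i 1"])
    then have "(1 / c) *\<^sub>R (c *\<^sub>R axis i 1) \<in> span ((+) (- p) ` P)" by (rule span_scale)
    then show "axis i 1 \<in> span ((+) (- p) ` P)" using c(1) by simp
  qed
  moreover have "(+) (- p) ` P \<subseteq> coord_space A" using sub by auto
  ultimately have "dim ((+) (- p) ` P) = dim (coord_space A)"
    by (metis dim_span dim_subset order_antisym)
  then show ?thesis using eq by (simp add: dim_coord_space)
qed

lemma linear_swap_coord: "linear (swap_coord i j)"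
  by (rule linearI) (auto simp: swap_coord_def vec_eq_iff)

lemma inj_swap_coord: "inj (swap_coord i j)"
  by (rule inj_on_inverseI[of _ "swap_coord i j"]) (simp add: swap_coord_def vec_eq_iff)

text \<open>An affine map has convex preimages of convex sets, so checking the generators is
  enough.\<close>

lemma raise_coord_convex_hull:
  assumes "\<And>x. x \<in> X \<Longrightarrow> raise_coord i x \<in> convex hull X" "x \<in> convex hull X"
  shows "raise_coord i x \<in> convex hull X"
proof -
  have "raise_coord i (s *\<^sub>R x + t *\<^sub>R y) = s *\<^sub>R raise_coord i x + t *\<^sub>R raise_coord i y"
    if "s + t = 1" for s t and x y :: "real ^ 'a"
    using that by (simp add: raise_coord_def vec_eq_iff)
  then have "convex {x. raise_coord i x \<in> convex hull X}"
    by (auto simp: convex_def intro!: convexD[OF convex_convex_hull])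
  then have "convex hull X \<subseteq> {x. raise_coord i x \<in> convex hull X}"
    using assms(1) by (intro hull_minimal) auto
  then show ?thesis using assms(2) by auto
qed

text \<open>The point \<open>p\<close> makes the face proper, which bounds its dimension above by
  \<open>aff_dim P - 1\<close>; the set \<open>Y\<close> of tight points gives the matching lower
  bound.\<close>

lemma facet_definingI:
  fixes P :: "'a::euclidean_space set"
  assumes l: "linear l" and P: "convex P" and valid: "\<And>x. x \<in> P \<Longrightarrow> l x \<ge> b"
    and proper: "p \<in> P" "l p \<noteq> b"
    and Y: "Y \<subseteq> P" "\<And>y. y \<in> Y \<Longrightarrow> l y = b" "Y \<noteq> {}" "aff_dim P \<le> aff_dim Y + 1"
  shows "facet_defining P l b"
proof -
  let ?F = "{x \<in> P. l x = b}"
  \<comment> \<open>The vector \<open>adjoint l 1\<close> represents the linear form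
    \<open>l\<close> and is the normal of the supporting hyperplane.\<close>
  have l_inner: "l x = adjoint l 1 \<bullet> x" for x
    using adjoint_works[OF l, of x 1] by (simp add: inner_commute)
  then have "?F = P \<inter> {x. adjoint l 1 \<bullet> x = b}" by auto
  moreover have "\<dots> face_of P"
    using valid l_inner by (intro face_of_Int_supporting_hyperplane_ge[OF P]) auto
  ultimately have face: "?F face_of P" by simp
  then have "aff_dim ?F < aff_dim P"
    using face_of_aff_dim_lt[OF P face] proper by auto
  moreover have "aff_dim Y \<le> aff_dim ?F" using Y by (intro aff_dim_subset) auto
  ultimately have "?F facet_of P" using face Y by (auto simp: facet_of_def)
  then show ?thesis using l valid by (simp add: facet_defining_def)
qed

section \<open>Multicuts in terms of walks\<close>

lemma component_eq_iff:
  assumes "t \<in> V"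
  shows "component V E s = component V E t \<longleftrightarrow> (s, t) \<in> (adj E)\<^sup>*"
proof
  assume "component V E s = component V E t"
  \<comment> \<open>Components contain only nodes of \<open>V\<close>, so \<open>t\<close> lies in
    its own component because \<open>t\<close> is in \<open>V\<close>.\<close>
  moreover have "t \<in> component V E t" using assms by (simp add: component_def)
  ultimately have "t \<in> component V E s" by simp
  then show "(s, t) \<in> (adj E)\<^sup>*" by (simp add: component_def)
next
  assume st: "(s, t) \<in> (adj E)\<^sup>*"
  have "sym (adj E)" by (auto simp: sym_def insert_commute)
  then have "(t, s) \<in> (adj E)\<^sup>*" using st sym_rtrancl symD by fast
  then show "component V E s = component V E t"
    using st unfolding component_def by (auto intro: rtrancl_trans)
qed

lemma multicut_iff:
  assumes "S \<subseteq> node_pairs V"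
  shows "multicut V E S \<delta> \<longleftrightarrow>
    \<delta> \<subseteq> E \<and> (\<forall>s t. {s, t} \<in> S \<longrightarrow> (s, t) \<notin> (adj (E - \<delta>))\<^sup>*)"
proof -
  have "t \<in> V" if "{s, t} \<in> S" for s t
    using that assms by (auto simp: node_pairs_def)
  then show ?thesis by (auto simp: multicut_def component_eq_iff)
qed

lemma multicut_superset:
  assumes "S \<subseteq> node_pairs V" "multicut V E S \<delta>" "\<delta> \<subseteq> \<delta>'" "\<delta>' \<subseteq> E"
  shows "multicut V E S \<delta>'"
proof -
  have "(adj (E - \<delta>'))\<^sup>* \<subseteq> (adj (E - \<delta>))\<^sup>*" using assms(3) by (intro rtrancl_mono) auto
  then show ?thesis using assms by (auto simp: multicut_iff)
qed

text \<open>At most the edge \<open>e\<close> stays uncut, and its ends are not a pair of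
  \<open>S\<close>.\<close>

lemma multicut_remove_edge:
  assumes "S \<subseteq> node_pairs V" "e \<notin> S"
  shows "multicut V E S (E - {e})"
proof -
  have "s = t \<or> {s, t} = e" if "(s, t) \<in> (adj (E - (E - {e})))\<^sup>*" for s t
    using that by (induction rule: rtrancl_induct) (auto simp: doubleton_eq_iff insert_commute)
  moreover have "s \<noteq> t" if "{s, t} \<in> S" for s t
    using that assms(1) by (auto simp: node_pairs_def)
  ultimately show ?thesis using assms by (force simp: multicut_iff)
qed

lemma multicut_all:
  assumes "S \<subseteq> node_pairs V"
  shows "multicut V E S E"
proof -
  \<comment> \<open>The empty set is not a node pair, so the previous lemma applies with
    \<open>e = {}\<close>; the resulting multicut is then enlarged to \<open>E\<close>.\<close>
  have "{} \<notin> S" using assms by (auto simp: node_pairs_def)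
  then show ?thesis
    by (intro multicut_superset[OF assms multicut_remove_edge[OF assms]]) auto
qed

lemma edge_in_multicut:
  assumes "S \<subseteq> node_pairs V" "multicut V E S \<delta>" "e \<in> E" "e \<in> S"
  shows "e \<in> \<delta>"
proof (rule ccontr)
  assume "e \<notin> \<delta>"
  obtain s t where st: "e = {s, t}"
    using assms(1,4) by (auto simp: node_pairs_def card_2_iff)
  then have "(s, t) \<in> (adj (E - \<delta>))\<^sup>*" using assms(3) \<open>e \<notin> \<delta>\<close> by auto
  then show False using assms st by (auto simp: multicut_iff)
qed

section \<open>The multicut polytope and its dimension\<close>

lemma incidence_in_polytope:
  "multicut V E S \<delta> \<Longrightarrow> incidence_vector \<delta> \<in> multicut_polytope V E S"
  by (auto simp: multicut_polytope_def intro: hull_inc)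

lemma multicut_polytope_induct:
  assumes "x \<in> multicut_polytope V E S" "convex T"
    "\<And>\<delta>. multicut V E S \<delta> \<Longrightarrow> incidence_vector \<delta> \<in> T"
  shows "x \<in> T"
proof -
  have "multicut_polytope V E S \<subseteq> T"
    unfolding multicut_polytope_def using assms(2,3) by (intro hull_minimal) auto
  then show ?thesis using assms(1) by blast
qed

lemma multicut_polytope_coord_space:
  "multicut_polytope V E S \<subseteq> coord_space E"
proof
  fix x assume "x \<in> multicut_polytope V E S"
  then show "x \<in> coord_space E"
    by (rule multicut_polytope_induct[OF _ subspace_imp_convex[OF subspace_coord_space]])
      (auto simp: coord_space_def incidence_vector_def multicut_def)
qed

lemma multicut_polytope_fixed_coord:
  assumes "S \<subseteq> node_pairs V" "e \<in> E" "e \<in> S" "x \<in> multicut_polytope V E S"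
  shows "x $ e = 1"
proof -
  have "convex {x :: real ^ 'a set. x $ e = 1}"
    by (auto simp: convex_def simp flip: distrib_right)
  then have "x \<in> {x. x $ e = 1}"
    by (rule multicut_polytope_induct[OF assms(4)])
      (use assms edge_in_multicut in \<open>auto simp: incidence_vector_def\<close>)
  then show ?thesis by simp
qed

lemma raise_coord_multicut_polytope:
  assumes "S \<subseteq> node_pairs V" "e \<in> E" "x \<in> multicut_polytope V E S"
  shows "raise_coord e x \<in> multicut_polytope V E S"
  unfolding multicut_polytope_def
proof (rule raise_coord_convex_hull)
  fix y assume "y \<in> {incidence_vector \<delta> |\<delta>. multicut V E S \<delta>}"
  then obtain \<delta> where \<delta>: "y = incidence_vector \<delta>" "multicut V E S \<delta>" by auto
  then have "multicut V E S (insert e \<delta>)"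
    using assms(2) by (intro multicut_superset[OF assms(1) \<delta>(2)]) (auto simp: multicut_def)
  moreover have "raise_coord e y = incidence_vector (insert e \<delta>)"
    by (auto simp: \<delta> raise_coord_def incidence_vector_def vec_eq_iff)
  ultimately show "raise_coord e y \<in> convex hull {incidence_vector \<delta> |\<delta>. multicut V E S \<delta>}"
    by (auto intro: hull_inc)
qed (use assms in \<open>simp add: multicut_polytope_def\<close>)

lemma aff_dim_multicut_polytope:
  assumes "S \<subseteq> node_pairs V"
  shows "aff_dim (multicut_polytope V E S) = int (card (E - S))"
proof (rule aff_dim_eq_card_coords)
  show E: "incidence_vector E \<in> multicut_polytope V E S"
    by (intro incidence_in_polytope multicut_all assms)
  show "x - incidence_vector E \<in> coord_space (E - S)" if "x \<in> multicut_polytope V E S" for x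
    using multicut_polytope_coord_space[of V E S] multicut_polytope_fixed_coord[OF assms] that
    by (fastforce simp: coord_space_def incidence_vector_def)
  show "\<exists>c. c \<noteq> 0 \<and> incidence_vector E + c *\<^sub>R axis e 1 \<in> multicut_polytope V E S"
    if "e \<in> E - S" for e
  proof (intro exI[of _ "-1"] conjI)
    have "incidence_vector E + (-1) *\<^sub>R axis e 1 = incidence_vector (E - {e})"
      using that by (auto simp: incidence_vector_def vec_eq_iff axis_def)
    then show "incidence_vector E + (-1) *\<^sub>R axis e 1 \<in> multicut_polytope V E S"
      using that assms by (auto intro!: incidence_in_polytope multicut_remove_edge)
  qed simp
qed

section \<open>The multicut dominant and its dimension\<close>

lemma polytope_subset_dominant: "multicut_polytope V E S \<subseteq> multicut_dominant V E S"
proof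
  fix x assume "x \<in> multicut_polytope V E S"
  moreover have "0 \<in> nonneg_orthant E" by (simp add: nonneg_orthant_def)
  ultimately show "x \<in> multicut_dominant V E S"
    unfolding multicut_dominant_def by force
qed

lemma dominant_add_axis:
  assumes "x \<in> multicut_dominant V E S" "e \<in> E" "0 \<le> c"
  shows "x + c *\<^sub>R axis e 1 \<in> multicut_dominant V E S"
proof -
  obtain q y where "x = q + y" "q \<in> multicut_polytope V E S" "y \<in> nonneg_orthant E"
    using assms(1) by (auto simp: multicut_dominant_def)
  moreover from this have "y + c *\<^sub>R axis e 1 \<in> nonneg_orthant E"
    using assms by (auto simp: nonneg_orthant_def axis_def)
  ultimately show ?thesis by (auto simp: multicut_dominant_def add.assoc)
qed

lemma dominant_coord_space: "multicut_dominant V E S \<subseteq> coord_space E"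
proof
  fix x assume "x \<in> multicut_dominant V E S"
  then obtain q y where "x = q + y" "q \<in> multicut_polytope V E S" "y \<in> nonneg_orthant E"
    by (auto simp: multicut_dominant_def)
  moreover from this have "y \<in> coord_space E" by (simp add: nonneg_orthant_def coord_space_def)
  ultimately show "x \<in> coord_space E"
    using multicut_polytope_coord_space[of V E S] subspace_add[OF subspace_coord_space] by blast
qed

lemma convex_dominant: "convex (multicut_dominant V E S)"
proof -
  have "convex (nonneg_orthant E :: (real ^ 'a set) set)"
    by (auto simp: convex_def nonneg_orthant_def)
  moreover have "convex (multicut_polytope V E S)" by (simp add: multicut_polytope_def)
  moreover have "multicut_dominant V E S =
      (\<Union>x\<in>multicut_polytope V E S. \<Union>y\<in>nonneg_orthant E. {x + y})"
    by (auto simp: multicut_dominant_def)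
  ultimately show ?thesis using convex_sums by metis
qed

lemma aff_dim_dominant:
  assumes "S \<subseteq> node_pairs V"
  shows "aff_dim (multicut_dominant V E S) = int (card E)"
proof (rule aff_dim_eq_card_coords)
  show E: "incidence_vector E \<in> multicut_dominant V E S"
    using polytope_subset_dominant[of V E S]
    by (auto intro!: incidence_in_polytope multicut_all assms)
  show "x - incidence_vector E \<in> coord_space E" if "x \<in> multicut_dominant V E S" for x
    using dominant_coord_space[of V E S] that E subspace_diff[OF subspace_coord_space] by blast
  show "\<exists>c. c \<noteq> 0 \<and> incidence_vector E + c *\<^sub>R axis e 1 \<in> multicut_dominant V E S" if "e \<in> E" for e
    using dominant_add_axis[OF E that, of 1] by (intro exI[of _ 1]) simp
qed

section \<open>Coefficients of facets of the dominant\<close>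

lemma sum_mult_add_axis:
  fixes a x :: "real ^ 'i::finite"
  assumes "e \<in> A"
  shows "(\<Sum>i\<in>A. a $ i * (x + c *\<^sub>R axis e 1) $ i) = (\<Sum>i\<in>A. a $ i * x $ i) + a $ e * c"
proof -
  have "(\<Sum>i\<in>A. a $ i * (x + c *\<^sub>R axis e 1) $ i) =
      (\<Sum>i\<in>A. a $ i * x $ i + (if i = e then a $ e * c else 0))"
    by (intro sum.cong) (auto simp: axis_def algebra_simps)
  then show ?thesis using assms by (simp add: sum.distrib)
qed

text \<open>Increasing coordinate \<open>e\<close> of a tight point stays in the dominant, so
  validity forbids a decrease of the left-hand side.\<close>

lemma dominant_facet_nonneg:
  assumes facet: "facet_defining (multicut_dominant V E S) (\<lambda>x. \<Sum>e\<in>E. a $ e * x $ e) b"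
    and "e \<in> E"
  shows "0 \<le> a $ e"
proof -
  obtain x where x: "x \<in> multicut_dominant V E S" "(\<Sum>e\<in>E. a $ e * x $ e) = b"
    using facet by (auto simp: facet_defining_def facet_of_def)
  have "b \<le> (\<Sum>i\<in>E. a $ i * (x + 1 *\<^sub>R axis e 1) $ i)"
    using dominant_add_axis[OF x(1) assms(2), of 1] facet by (auto simp: facet_defining_def)
  also have "\<dots> = b + a $ e"
    using sum_mult_add_axis[OF assms(2), of a x 1] x(2) by simp
  finally show ?thesis by simp
qed

text \<open>By dimension, a facet inside the hyperplane \<open>x\<^sub>f = c\<close> spans that hyperplane of \<open>\<real>\<^sup>E\<close>.\<close>

lemma dominant_facet_in_coordinate_hyperplane:
  fixes V :: "'v::finite set" and a :: "real ^ ('v set)"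
  assumes S: "S \<subseteq> node_pairs V"
    and facet: "facet_defining (multicut_dominant V E S) (\<lambda>x. \<Sum>e\<in>E. a $ e * x $ e) b"
    and f: "f \<in> E"
    and const: "\<And>x. x \<in> multicut_dominant V E S \<Longrightarrow> (\<Sum>e\<in>E. a $ e * x $ e) = b \<Longrightarrow> x $ f = c"
  shows "b = a $ f * c" and "\<And>e. e \<in> E \<Longrightarrow> e \<noteq> f \<Longrightarrow> a $ e = 0"
proof -
  let ?l = "\<lambda>x. \<Sum>e\<in>E. a $ e * x $ e"
  let ?F = "{x \<in> multicut_dominant V E S. ?l x = b}"
  define H where "H = (+) (c *\<^sub>R axis f 1) ` coord_space (E - {f})"
  have F_H: "?F \<subseteq> H"
  proof
    fix x assume x: "x \<in> ?F"
    then have "x - c *\<^sub>R axis f 1 \<in> coord_space (E - {f})"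
      using const dominant_coord_space[of V E S]
      by (auto simp: coord_space_def axis_def)
    then show "x \<in> H" unfolding H_def by (intro image_eqI[of _ _ "x - c *\<^sub>R axis f 1"]) auto
  qed
  have "aff_dim ?F = int (card E) - 1"
    using facet aff_dim_dominant[OF S, of E] by (simp add: facet_defining_def facet_of_def)
  moreover have "aff_dim H = int (card E) - 1"
    using card_Suc_Diff1[OF finite f] unfolding H_def aff_dim_translation_eq aff_dim_coord_space
    by linarith
  \<comment> \<open>Inclusion and equal dimension give equal affine hulls, so the form takes the
    value \<open>b\<close> on all of \<open>H\<close>.\<close>
  ultimately have "affine hull ?F = affine hull H"
    using aff_dim_eq_full_gen[OF F_H] by simp
  moreover have "?l (s *\<^sub>R x + t *\<^sub>R y) = s * ?l x + t * ?l y" for s t x y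
    by (simp add: algebra_simps sum.distrib sum_distrib_left)
  then have "affine {x. ?l x = b}" by (simp add: affine_def flip: distrib_right)
  then have "affine hull ?F \<subseteq> {x. ?l x = b}" by (intro hull_minimal) auto
  ultimately have H: "?l x = b" if "x \<in> H" for x using that hull_inc by fastforce
  have l_axis: "?l (c *\<^sub>R axis f 1) = a $ f * c"
    using sum_mult_add_axis[OF f, of a 0 c] by simp
  \<comment> \<open>The form is evaluated at two kinds of points of \<open>H\<close>: the base point
    yields \<open>b\<close>, and its shift by \<open>axis e 1\<close> then forces
    \<open>a $ e = 0\<close>.\<close>
  have "?l (c *\<^sub>R axis f 1) = b"
    by (intro H) (simp add: H_def image_iff coord_space_def)
  then show b: "b = a $ f * c" using l_axis by simp
  show "a $ e = 0" if e: "e \<in> E" "e \<noteq> f" for e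
  proof -
    have "?l (c *\<^sub>R axis f 1 + 1 *\<^sub>R axis e 1) = b"
      using e by (intro H) (auto simp: H_def coord_space_def axis_def)
    then show ?thesis
      unfolding sum_mult_add_axis[OF e(1)] l_axis using b by simp
  qed
qed

section \<open>Multicuts under subdivision of an edge\<close>

locale edge_subdivision =
  fixes V :: "'v::finite set" and E S :: "'v set set" and u v w :: 'v and f f\<^sub>1 f\<^sub>2 :: "'v set"
  assumes graph: "simple_graph V E" and S: "S \<subseteq> node_pairs V"
    and f_in_E: "f \<in> E" and w_notin: "w \<notin> V"
    and f_eq: "f = {u, v}" and f\<^sub>1_eq: "f\<^sub>1 = {u, w}" and f\<^sub>2_eq: "f\<^sub>2 = {w, v}"
begin

abbreviation "Vbar \<equiv> insert w V"
abbreviation "Ebar \<equiv> (E - {f}) \<union> {f\<^sub>1, f\<^sub>2}"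

text \<open>Exchanging \<open>u\<close> and \<open>v\<close> exchanges the two halves of
  \<open>f\<close>, so each fact about \<open>f\<^sub>1\<close> also yields the one about
  \<open>f\<^sub>2\<close>.\<close>

lemma swapped: "edge_subdivision V E S v u w f f\<^sub>2 f\<^sub>1"
  using graph S f_in_E w_notin f_eq f\<^sub>1_eq f\<^sub>2_eq by unfold_locales (auto simp: insert_commute)

text \<open>Both halves contain \<open>w\<close>, whereas edges and pairs of \<open>S\<close> lie
  inside \<open>V\<close>. The halves differ since \<open>f\<close> has two distinct ends.\<close>

lemma new_edges [simp]: "f\<^sub>1 \<notin> E" "f\<^sub>2 \<notin> E" "f\<^sub>1 \<notin> S" "f\<^sub>2 \<notin> S"
  "f\<^sub>1 \<noteq> f\<^sub>2" "f\<^sub>2 \<noteq> f\<^sub>1" "f\<^sub>1 \<noteq> f" "f \<noteq> f\<^sub>1" "f\<^sub>2 \<noteq> f" "f \<noteq> f\<^sub>2"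
  using graph S f_in_E w_notin unfolding f_eq f\<^sub>1_eq f\<^sub>2_eq
  by (auto simp: simple_graph_def node_pairs_def doubleton_eq_iff)

lemma Sbar: "S \<subseteq> node_pairs Vbar"
  using S by (auto simp: node_pairs_def)

text \<open>Here \<open>f\<close> is cut as soon as one half is. If \<open>f\<close> is uncut, then
  both halves are, and the path through \<open>w\<close> replaces \<open>f\<close>; thus walks
  avoiding the contracted multicut expand to walks avoiding \<open>\<delta>\<close>.\<close>

lemma multicut_contract:
  assumes "multicut Vbar Ebar S \<delta>"
  shows "multicut V E S ((\<delta> - {f\<^sub>1, f\<^sub>2}) \<union> (if f\<^sub>1 \<in> \<delta> \<or> f\<^sub>2 \<in> \<delta> then {f} else {}))"
    (is "multicut V E S ?\<delta>")
proof -
  have "adj (E - ?\<delta>) \<subseteq> (adj (Ebar - \<delta>))\<^sup>*"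
  proof (rule subrelI)
    fix x y assume "(x, y) \<in> adj (E - ?\<delta>)"
    then have xy: "{x, y} \<in> E" "{x, y} \<notin> ?\<delta>" by auto
    show "(x, y) \<in> (adj (Ebar - \<delta>))\<^sup>*"
    proof (cases "{x, y} = f")
      case True
      then have "f\<^sub>1 \<in> Ebar - \<delta>" "f\<^sub>2 \<in> Ebar - \<delta>" using xy by (auto split: if_splits)
      then have "(u, w) \<in> adj (Ebar - \<delta>)" "(w, v) \<in> adj (Ebar - \<delta>)"
        "(w, u) \<in> adj (Ebar - \<delta>)" "(v, w) \<in> adj (Ebar - \<delta>)"
        by (simp_all add: f\<^sub>1_eq f\<^sub>2_eq insert_commute)
      then have "(u, v) \<in> (adj (Ebar - \<delta>))\<^sup>*" "(v, u) \<in> (adj (Ebar - \<delta>))\<^sup>*"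
        by (meson r_into_rtrancl rtrancl.rtrancl_into_rtrancl)+
      then show ?thesis using True unfolding f_eq doubleton_eq_iff by blast
    next
      case False
      moreover have "{x, y} \<noteq> f\<^sub>1" "{x, y} \<noteq> f\<^sub>2" using xy(1) new_edges(1,2) by metis+
      ultimately have "{x, y} \<in> Ebar - \<delta>" using xy by simp
      then show ?thesis by auto
    qed
  qed
  then have "(adj (E - ?\<delta>))\<^sup>* \<subseteq> (adj (Ebar - \<delta>))\<^sup>*" by (rule rtrancl_subset_rtrancl)
  moreover have "?\<delta> \<subseteq> E" using assms f_in_E by (auto simp: multicut_def)
  ultimately show ?thesis using assms by (auto simp: multicut_iff[OF S] multicut_iff[OF Sbar])
qed

text \<open>Contracting \<open>w\<close> to \<open>v\<close> maps walks that avoid the lifted multicut to walks that avoid \<open>\<delta>\<close>.\<close>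

lemma multicut_lift:
  assumes "multicut V E S \<delta>"
  shows "multicut Vbar Ebar S ((\<delta> - {f}) \<union> (if f \<in> \<delta> then {f\<^sub>1} else {}))"
    (is "multicut Vbar Ebar S ?\<delta>")
proof -
  define c where "c x = (if x = w then v else x)" for x
  have c_step: "(c x, c y) \<in> (adj (E - \<delta>))\<^sup>*" if edge: "{x, y} \<in> Ebar - ?\<delta>" for x y
  proof -
    consider "{x, y} \<in> E - {f}" | "{x, y} = f\<^sub>1" | "{x, y} = f\<^sub>2" using edge by auto
    then show ?thesis
    proof cases
      case 1
      then have "c x = x" "c y = y"
        using graph w_notin by (auto simp: c_def simple_graph_def node_pairs_def)
      then show ?thesis using 1 that by auto
    next
      case 2
      \<comment> \<open>If \<open>f\<close> were cut, the lift would contain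
        \<open>f\<^sub>1\<close>.\<close>
      then have "f \<in> E - \<delta>" using that f_in_E by (auto split: if_splits)
      then have "(u, v) \<in> adj (E - \<delta>)" "(v, u) \<in> adj (E - \<delta>)" by (simp_all add: f_eq insert_commute)
      then show ?thesis using 2 w_notin by (auto simp: c_def f\<^sub>1_eq doubleton_eq_iff)
    next
      case 3
      \<comment> \<open>The edge \<open>f\<^sub>2\<close> collapses to the single node
        \<open>v\<close>, which is why the lift never has to cut it.\<close>
      then show ?thesis by (auto simp: c_def f\<^sub>2_eq doubleton_eq_iff)
    qed
  qed
  have "(c x, c y) \<in> (adj (E - \<delta>))\<^sup>*" if "(x, y) \<in> (adj (Ebar - ?\<delta>))\<^sup>*" for x y
    using that
  proof (induction rule: rtrancl_induct)
    case (step y z)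
    then show ?case using c_step[of y z] by (auto intro: rtrancl_trans)
  qed simp
  moreover have "c s = s" "c t = t" if "{s, t} \<in> S" for s t
    using that S w_notin by (auto simp: c_def node_pairs_def)
  ultimately have "(s, t) \<notin> (adj (Ebar - ?\<delta>))\<^sup>*" if "{s, t} \<in> S" for s t
    using assms that by (metis multicut_iff[OF S])
  moreover have "?\<delta> \<subseteq> Ebar" using assms by (auto simp: multicut_def)
  ultimately show ?thesis by (simp add: multicut_iff[OF Sbar])
qed

section \<open>Copies of the old polyhedra inside the new ones\<close>

lemma swap_coord_polytope:
  assumes "x \<in> multicut_polytope V E S"
  shows "swap_coord f f\<^sub>1 x \<in> multicut_polytope Vbar Ebar S"
proof -
  have "convex {x. swap_coord f f\<^sub>1 x \<in> multicut_polytope Vbar Ebar S}"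
    using convex_linear_vimage[OF linear_swap_coord[of f f\<^sub>1], of "multicut_polytope Vbar Ebar S"]
    by (simp add: vimage_def multicut_polytope_def)
  moreover have "swap_coord f f\<^sub>1 (incidence_vector \<delta>) \<in> multicut_polytope Vbar Ebar S"
    if "multicut V E S \<delta>" for \<delta>
  proof -
    have "f\<^sub>1 \<notin> \<delta>" using that by (auto simp: multicut_def)
    \<comment> \<open>On incidence vectors the swap is exactly the lift of multicuts; linearity
      carries this over to convex combinations.\<close>
    then have "swap_coord f f\<^sub>1 (incidence_vector \<delta>) =
        incidence_vector ((\<delta> - {f}) \<union> (if f \<in> \<delta> then {f\<^sub>1} else {}))"
      by (auto simp: swap_coord_def incidence_vector_def vec_eq_iff Transposition.transpose_def)
    then show ?thesis using multicut_lift[OF that] by (simp add: incidence_in_polytope)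
  qed
  ultimately have "x \<in> {x. swap_coord f f\<^sub>1 x \<in> multicut_polytope Vbar Ebar S}"
    by (intro multicut_polytope_induct[OF assms]) auto
  then show ?thesis by simp
qed

lemma swap_coord_dominant:
  assumes "x \<in> multicut_dominant V E S"
  shows "swap_coord f f\<^sub>1 x \<in> multicut_dominant Vbar Ebar S"
proof -
  obtain q y where x: "x = q + y" "q \<in> multicut_polytope V E S" "y \<in> nonneg_orthant E"
    using assms by (auto simp: multicut_dominant_def)
  have "swap_coord f f\<^sub>1 y \<in> nonneg_orthant Ebar"
    using x(3) f_in_E by (auto simp: nonneg_orthant_def swap_coord_def Transposition.transpose_def)
  moreover have "swap_coord f f\<^sub>1 x = swap_coord f f\<^sub>1 q + swap_coord f f\<^sub>1 y"
    using x(1) linear_add[OF linear_swap_coord] by blast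
  ultimately show ?thesis
    using swap_coord_polytope[OF x(2)] by (auto simp: multicut_dominant_def)
qed

lemma swap_coord_nth:
  assumes "x \<in> coord_space E"
  shows "swap_coord f f\<^sub>1 x $ e =
    (if e = f\<^sub>1 then x $ f else if e = f then 0 else x $ e)"
  using assms by (auto simp: swap_coord_def Transposition.transpose_def coord_space_def)

lemma swap_coord_polytope':
  "x \<in> multicut_polytope V E S \<Longrightarrow> swap_coord f f\<^sub>2 x \<in> multicut_polytope Vbar Ebar S"
  using edge_subdivision.swap_coord_polytope[OF swapped, of x] by (simp add: insert_commute)

lemma swap_coord_dominant':
  "x \<in> multicut_dominant V E S \<Longrightarrow> swap_coord f f\<^sub>2 x \<in> multicut_dominant Vbar Ebar S"
  using edge_subdivision.swap_coord_dominant[OF swapped, of x] by (simp add: insert_commute)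

lemma swap_coord_nth':
  "x \<in> coord_space E \<Longrightarrow>
    swap_coord f f\<^sub>2 x $ e = (if e = f\<^sub>2 then x $ f else if e = f then 0 else x $ e)"
  using edge_subdivision.swap_coord_nth[OF swapped, of x e] by (simp add: insert_commute)

text \<open>The halves are never in \<open>S\<close>, while \<open>f\<close> counts on the old side
  only if it is not in \<open>S\<close>. This is the growth in dimension of the polytope.\<close>

lemma card_Ebar_diff:
  "int (card (Ebar - S)) = int (card (E - S)) + (if f \<in> S then 2 else 1)"
proof -
  define n where "n = card (E - S - {f})"
  have "Ebar - S = insert f\<^sub>1 (insert f\<^sub>2 (E - S - {f}))" by auto
  then have Ebar: "card (Ebar - S) = Suc (Suc n)" by (simp add: n_def)
  show ?thesis
  proof (cases "f \<in> S")
    case True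
    then have "E - S - {f} = E - S" by auto
    then have "card (E - S) = n" by (simp only: n_def)
    then show ?thesis unfolding Ebar using True by simp
  next
    case False
    then have "card (E - S) = Suc n"
      unfolding n_def using f_in_E by (intro card_Suc_Diff1[symmetric]) auto
    then show ?thesis unfolding Ebar using False by simp
  qed
qed

lemma card_Ebar: "int (card Ebar) = int (card E) + 1"
proof -
  have "Ebar = insert f\<^sub>1 (insert f\<^sub>2 (E - {f}))" by auto
  then have "card Ebar = Suc (Suc (card (E - {f})))" by simp
  then show ?thesis using card_Suc_Diff1[OF _ f_in_E] by simp
qed

section \<open>Validity of the lifted inequality\<close>

context
  fixes a :: "real ^ ('v set)" and b :: real
begin

abbreviation "l x \<equiv> \<Sum>e\<in>E. a $ e * x $ e"
abbreviation "lbar x \<equiv> a $ f * (x $ f\<^sub>1 + x $ f\<^sub>2) + (\<Sum>e\<in>E - {f}. a $ e * x $ e)"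

lemma l_split: "l x = a $ f * x $ f + (\<Sum>e\<in>E - {f}. a $ e * x $ e)"
  using f_in_E by (simp add: sum.remove)

lemma linear_lbar: "linear lbar"
  by (rule linearI) (simp_all add: algebra_simps sum.distrib sum_distrib_left)

text \<open>One half inherits the value \<open>x $ f\<close> and the other gets 0, so their sum is
  \<open>x $ f\<close>.\<close>

lemma lbar_swap_coord:
  assumes "x \<in> coord_space E"
  shows "lbar (swap_coord f f\<^sub>1 x) = l x" "lbar (swap_coord f f\<^sub>2 x) = l x"
proof -
  have "x $ f\<^sub>1 = 0" "x $ f\<^sub>2 = 0" using assms by (auto simp: coord_space_def)
  moreover have "swap_coord f f\<^sub>1 x $ e = x $ e" "swap_coord f f\<^sub>2 x $ e = x $ e"
    if "e \<in> E - {f}" for e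
  proof -
    have "e \<noteq> f" "e \<noteq> f\<^sub>1" "e \<noteq> f\<^sub>2" using that new_edges(1,2) by (metis DiffD1 DiffD2 singletonI)+
    then show "swap_coord f f\<^sub>1 x $ e = x $ e" "swap_coord f f\<^sub>2 x $ e = x $ e"
      using assms by (simp_all add: swap_coord_nth swap_coord_nth')
  qed
  then have "(\<Sum>e\<in>E - {f}. a $ e * swap_coord f f\<^sub>1 x $ e) = (\<Sum>e\<in>E - {f}. a $ e * x $ e)"
    "(\<Sum>e\<in>E - {f}. a $ e * swap_coord f f\<^sub>2 x $ e) = (\<Sum>e\<in>E - {f}. a $ e * x $ e)"
    by (auto intro!: sum.cong)
  ultimately show "lbar (swap_coord f f\<^sub>1 x) = l x" "lbar (swap_coord f f\<^sub>2 x) = l x"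
    using assms by (simp_all add: l_split swap_coord_nth swap_coord_nth')
qed

text \<open>Contracting a multicut puts at \<open>f\<close> the maximum of the entries at the two
  halves. This is at most their sum, and \<open>a $ f\<close> is nonnegative.\<close>

lemma lbar_valid_polytope:
  assumes nonneg: "\<And>e. e \<in> E \<Longrightarrow> 0 \<le> a $ e"
    and valid: "\<And>x. x \<in> multicut_polytope V E S \<Longrightarrow> b \<le> l x"
    and x: "x \<in> multicut_polytope Vbar Ebar S"
  shows "b \<le> lbar x"
proof -
  have "convex {x. b \<le> lbar x}"
    using convex_linear_vimage[OF linear_lbar, of "{b..}"] by (simp add: vimage_def)
  moreover have "b \<le> lbar (incidence_vector \<delta>)" if "multicut Vbar Ebar S \<delta>" for \<delta>
  proof -
    let ?\<delta> = "(\<delta> - {f\<^sub>1, f\<^sub>2}) \<union> (if f\<^sub>1 \<in> \<delta> \<or> f\<^sub>2 \<in> \<delta> then {f} else {})"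
    have "b \<le> l (incidence_vector ?\<delta>)"
      by (intro valid incidence_in_polytope multicut_contract that)
    also have "\<dots> \<le> lbar (incidence_vector \<delta>)"
    proof -
      have "f \<notin> \<delta>" using that by (auto simp: multicut_def)
      then have "incidence_vector ?\<delta> $ f \<le> incidence_vector \<delta> $ f\<^sub>1 + incidence_vector \<delta> $ f\<^sub>2"
        by (auto simp: incidence_vector_def)
      moreover have "(\<Sum>e\<in>E - {f}. a $ e * incidence_vector ?\<delta> $ e)
          = (\<Sum>e\<in>E - {f}. a $ e * incidence_vector \<delta> $ e)"
        by (intro sum.cong) (auto simp: incidence_vector_def)
      ultimately show ?thesis
        unfolding l_split using nonneg[OF f_in_E] by (simp only: add_right_mono mult_left_mono)
    qed
    finally show ?thesis .
  qed
  ultimately have "x \<in> {x. b \<le> lbar x}" by (intro multicut_polytope_induct[OF x]) auto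
  then show ?thesis by simp
qed

lemma lbar_valid_dominant:
  assumes nonneg: "\<And>e. e \<in> E \<Longrightarrow> 0 \<le> a $ e"
    and valid: "\<And>x. x \<in> multicut_polytope V E S \<Longrightarrow> b \<le> l x"
    and x: "x \<in> multicut_dominant Vbar Ebar S"
  shows "b \<le> lbar x"
proof -
  obtain q y where qy: "x = q + y" "q \<in> multicut_polytope Vbar Ebar S" "y \<in> nonneg_orthant Ebar"
    using x by (auto simp: multicut_dominant_def)
  have "0 \<le> lbar y"
    using qy(3) nonneg f_in_E
    by (intro add_nonneg_nonneg mult_nonneg_nonneg sum_nonneg) (auto simp: nonneg_orthant_def)
  then show ?thesis
    using lbar_valid_polytope[OF nonneg valid qy(2)] qy(1) linear_add[OF linear_lbar, of q y] by simp
qed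

section \<open>Dimension count for the dominant\<close>

lemma aff_dim_insert_swap_coord:
  assumes F: "F \<subseteq> coord_space E" and x: "x \<in> F" "x $ f \<noteq> 0"
  shows "aff_dim (insert (swap_coord f f\<^sub>2 x) (swap_coord f f\<^sub>1 ` F)) = aff_dim F + 1"
proof -
  have "y $ f\<^sub>2 = 0" if "y \<in> F" for y using that F by (auto simp: coord_space_def)
  then have "swap_coord f f\<^sub>1 ` F \<subseteq> {y. y $ f\<^sub>2 = 0}"
    using F by (auto simp: swap_coord_nth subset_iff)
  moreover have "affine {y :: real ^ ('v set). y $ f\<^sub>2 = 0}" by (auto simp: affine_def)
  ultimately have "affine hull (swap_coord f f\<^sub>1 ` F) \<subseteq> {y. y $ f\<^sub>2 = 0}" by (rule hull_minimal)
  \<comment> \<open>Coordinate \<open>f\<^sub>2\<close> vanishes on the whole first copy but equals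
    \<open>x $ f\<close> at the extra point.\<close>
  moreover have "swap_coord f f\<^sub>2 x $ f\<^sub>2 \<noteq> 0" using F x by (auto simp: swap_coord_nth')
  ultimately have "swap_coord f f\<^sub>2 x \<notin> affine hull (swap_coord f f\<^sub>1 ` F)" by auto
  then show ?thesis
    by (simp add: aff_dim_insert aff_dim_injective_linear_image linear_swap_coord inj_swap_coord)
qed

text \<open>If all tight points had \<open>x $ f = 0\<close>, the facet would span that hyperplane,
  and the inequality would be the excluded positive multiple of
  \<open>x $ f \<ge> 0\<close>.\<close>

lemma exists_tight_point_off_hyperplane:
  assumes facet: "facet_defining (multicut_dominant V E S) l b"
    and not_nonneg: "\<not> (b = 0 \<and> (\<exists>c>0. \<forall>e\<in>E. a $ e = (if e = f then c else 0)))"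
  obtains x where "x \<in> multicut_dominant V E S" "l x = b" "x $ f \<noteq> 0"
proof -
  have False if zero: "\<And>x. x \<in> multicut_dominant V E S \<Longrightarrow> l x = b \<Longrightarrow> x $ f = 0"
  proof -
    note hyperplane = dominant_facet_in_coordinate_hyperplane[OF S facet f_in_E zero]
    have b: "b = 0" using hyperplane(1) by simp
    have a: "a $ e = 0" if "e \<in> E" "e \<noteq> f" for e using hyperplane(2) that by blast
    have "a $ f \<noteq> 0"
    proof
      assume "a $ f = 0"
      \<comment> \<open>The form would vanish identically, making the whole dominant tight, but a
        facet is a proper face.\<close>
      then have "l x = b" for x using a b by (simp add: l_split)
      then show False using facet by (simp add: facet_defining_def facet_of_def)
    qed
    then have "0 < a $ f" using dominant_facet_nonneg[OF facet f_in_E] by simp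
    moreover have "\<forall>e\<in>E. a $ e = (if e = f then a $ f else 0)" using a by simp
    ultimately show False using not_nonneg b by blast
  qed
  then show thesis using that by blast
qed

lemma facet_dominant:
  assumes facet: "facet_defining (multicut_dominant V E S) l b"
    and not_nonneg: "\<not> (b = 0 \<and> (\<exists>c>0. \<forall>e\<in>E. a $ e = (if e = f then c else 0)))"
  shows "facet_defining (multicut_dominant Vbar Ebar S) lbar b"
proof -
  let ?P = "multicut_dominant V E S"
  let ?F = "{x \<in> ?P. l x = b}"
  have dim: "aff_dim ?F = aff_dim ?P - 1"
    using facet by (simp add: facet_defining_def facet_of_def)
  then have "?F \<noteq> ?P" by force
  then obtain p where p: "p \<in> ?P" "l p \<noteq> b" by blast
  obtain x where x: "x \<in> ?P" "l x = b" "x $ f \<noteq> 0"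
    by (rule exists_tight_point_off_hyperplane[OF facet not_nonneg])
  have P_sub: "y \<in> coord_space E" if "y \<in> ?P" for y using that dominant_coord_space[of V E S] by blast
  have valid: "b \<le> l y" if "y \<in> multicut_polytope V E S" for y
    using that facet polytope_subset_dominant[of V E S] by (auto simp: facet_defining_def)
  show ?thesis
  proof (rule facet_definingI[OF linear_lbar convex_dominant])
    show "b \<le> lbar y" if "y \<in> multicut_dominant Vbar Ebar S" for y
      by (rule lbar_valid_dominant[OF dominant_facet_nonneg[OF facet] valid that])
    show "swap_coord f f\<^sub>1 p \<in> multicut_dominant Vbar Ebar S" by (rule swap_coord_dominant[OF p(1)])
    show "lbar (swap_coord f f\<^sub>1 p) \<noteq> b" using p P_sub lbar_swap_coord by simp
    let ?Y = "insert (swap_coord f f\<^sub>2 x) (swap_coord f f\<^sub>1 ` ?F)"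
    show "?Y \<subseteq> multicut_dominant Vbar Ebar S"
      using x swap_coord_dominant swap_coord_dominant' by blast
    show "lbar y = b" if "y \<in> ?Y" for y
      using that x P_sub lbar_swap_coord by auto
    \<comment> \<open>The old facet has dimension \<open>card E - 1\<close>, so \<open>?Y\<close>
      has dimension \<open>card E\<close>, which is \<open>card Ebar - 1\<close>.\<close>
    have "aff_dim ?Y = aff_dim ?F + 1"
      using x P_sub by (intro aff_dim_insert_swap_coord) auto
    then show "aff_dim (multicut_dominant Vbar Ebar S) \<le> aff_dim ?Y + 1"
      using dim card_Ebar by (simp only: aff_dim_dominant[OF S] aff_dim_dominant[OF Sbar])
  qed simp
qed

section \<open>Tight points of the polytope and shared facets\<close>

lemma dominant_tight_decomposition:
  assumes facet: "facet_defining (multicut_dominant V E S) l b"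
    and x: "x \<in> multicut_dominant V E S" "l x = b"
  obtains q y where "x = q + y" "q \<in> multicut_polytope V E S" "l q = b" "a $ f * y $ f = 0"
proof -
  obtain q y where qy: "x = q + y" "q \<in> multicut_polytope V E S" "y \<in> nonneg_orthant E"
    using x by (auto simp: multicut_dominant_def)
  have ay: "0 \<le> a $ e * y $ e" if "e \<in> E" for e
    using that dominant_facet_nonneg[OF facet that] qy(3) by (simp add: nonneg_orthant_def)
  \<comment> \<open>The values \<open>l q \<ge> b\<close> and \<open>l y \<ge> 0\<close> add up to
    \<open>b\<close>, so both bounds are tight; each nonnegative summand of \<open>l y\<close> is
    then zero.\<close>
  have "b \<le> l q"
    using qy(2) facet polytope_subset_dominant[of V E S] by (auto simp: facet_defining_def)
  moreover have "0 \<le> l y" by (intro sum_nonneg ay)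
  moreover have "l x = l q + l y" using qy(1) by (simp add: algebra_simps sum.distrib)
  ultimately have "l q = b" "l y = 0" using x(2) by auto
  moreover from this have "a $ f * y $ f = 0" using ay f_in_E by (simp add: sum_nonneg_eq_0_iff)
  ultimately show thesis using that qy(1,2) by blast
qed

text \<open>A tight point of the polytope is found inside a tight point of the dominant; if its \<open>f\<close>
  coordinate got lost then \<open>a\<^sub>f = 0\<close>, and adding \<open>f\<close> to every multicut keeps the point tight.\<close>

lemma polytope_tight_point_off_hyperplane:
  assumes facet: "facet_defining (multicut_dominant V E S) l b"
    and not_nonneg: "\<not> (b = 0 \<and> (\<exists>c>0. \<forall>e\<in>E. a $ e = (if e = f then c else 0)))"
  obtains x where "x \<in> multicut_polytope V E S" "l x = b" "x $ f \<noteq> 0"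
proof -
  obtain x where x: "x \<in> multicut_dominant V E S" "l x = b" "x $ f \<noteq> 0"
    by (rule exists_tight_point_off_hyperplane[OF facet not_nonneg])
  obtain q y where qy: "x = q + y" "q \<in> multicut_polytope V E S" "l q = b" "a $ f * y $ f = 0"
    by (rule dominant_tight_decomposition[OF facet x(1,2)])
  show thesis
  proof (cases "q $ f = 0")
    case False
    then show thesis using that qy(2,3) by blast
  next
    case True
    then have "y $ f \<noteq> 0" using qy(1) x(3) by simp
    then have "a $ f = 0" using qy(4) by simp
    then have "l (raise_coord f q) = l q"
      unfolding l_split by (auto intro!: sum.cong simp: raise_coord_def)
    then show thesis
      using that[of "raise_coord f q"] raise_coord_multicut_polytope[OF S f_in_E qy(2)] qy(3)
      by (simp add: raise_coord_def)
  qed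
qed

text \<open>If \<open>a $ f\<close> were nonzero, a tight point of the dominant would exceed its
  polytope part by nothing at \<open>f\<close>, where that part is 1. The facet would lie in
  \<open>x $ f = 1\<close>, and the inequality would hold with equality on the whole
  polytope.\<close>

lemma shared_facet_coeff_zero:
  assumes dom: "facet_defining (multicut_dominant V E S) l b"
    and poly: "facet_defining (multicut_polytope V E S) l b"
    and f_in_S: "f \<in> S"
  shows "a $ f = 0"
proof (rule ccontr)
  assume a_f: "a $ f \<noteq> 0"
  have "x $ f = 1" if x: "x \<in> multicut_dominant V E S" "l x = b" for x
  proof -
    obtain q y where qy: "x = q + y" "q \<in> multicut_polytope V E S" "l q = b" "a $ f * y $ f = 0"
      by (rule dominant_tight_decomposition[OF dom x])
    then show ?thesis
      using a_f qy(1,4) multicut_polytope_fixed_coord[OF S f_in_E f_in_S qy(2)] by simp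
  qed
  note hyperplane = dominant_facet_in_coordinate_hyperplane[OF S dom f_in_E this]
  have "b = a $ f" using hyperplane(1) by simp
  moreover have "a $ e = 0" if "e \<in> E" "e \<noteq> f" for e using hyperplane(2) that by blast
  ultimately have "l x = b" if "x \<in> multicut_polytope V E S" for x
    unfolding l_split using multicut_polytope_fixed_coord[OF S f_in_E f_in_S that] by simp
  then have "{x \<in> multicut_polytope V E S. l x = b} = multicut_polytope V E S" by blast
  then show False using poly by (simp add: facet_defining_def facet_of_def)
qed

lemma facet_polytope:
  assumes dom: "facet_defining (multicut_dominant V E S) l b"
    and poly: "facet_defining (multicut_polytope V E S) l b"
    and not_nonneg: "\<not> (b = 0 \<and> (\<exists>c>0. \<forall>e\<in>E. a $ e = (if e = f then c else 0)))"
  shows "facet_defining (multicut_polytope Vbar Ebar S) lbar b"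
proof -
  let ?Q = "multicut_polytope V E S"
  let ?F = "{x \<in> ?Q. l x = b}"
  have dim: "aff_dim ?F = aff_dim ?Q - 1"
    using poly by (simp add: facet_defining_def facet_of_def)
  then have "?F \<noteq> ?Q" by force
  then obtain p where p: "p \<in> ?Q" "l p \<noteq> b" by blast
  obtain x where x: "x \<in> ?Q" "l x = b" "x $ f \<noteq> 0"
    by (rule polytope_tight_point_off_hyperplane[OF dom not_nonneg])
  have Q_sub: "y \<in> coord_space E" if "y \<in> ?Q" for y
    using that multicut_polytope_coord_space[of V E S] by blast
  have valid: "b \<le> l y" if "y \<in> ?Q" for y
    using that poly by (auto simp: facet_defining_def)
  have convex: "convex (multicut_polytope Vbar Ebar S)" by (simp add: multicut_polytope_def)
  let ?Y = "insert (swap_coord f f\<^sub>2 x) (swap_coord f f\<^sub>1 ` ?F)"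
  have Y: "?Y \<subseteq> multicut_polytope Vbar Ebar S"
    using x swap_coord_polytope swap_coord_polytope' by blast
  have lbar_Y: "lbar y = b" if "y \<in> ?Y" for y
    using that x Q_sub lbar_swap_coord by auto
  have dim_Y: "aff_dim ?Y = aff_dim ?F + 1"
    using x Q_sub by (intro aff_dim_insert_swap_coord) auto
  have dim_Qbar: "aff_dim (multicut_polytope Vbar Ebar S) = aff_dim ?Q + (if f \<in> S then 2 else 1)"
    unfolding aff_dim_multicut_polytope[OF S] aff_dim_multicut_polytope[OF Sbar]
    by (rule card_Ebar_diff)
  \<comment> \<open>For \<open>f\<close> outside \<open>S\<close> the set \<open>?Y\<close> is large
    enough; for \<open>f\<close> in \<open>S\<close> one further dimension has to be found.\<close>
  have "\<exists>Z. Z \<noteq> {} \<and> Z \<subseteq> multicut_polytope Vbar Ebar S \<and> (\<forall>y\<in>Z. lbar y = b) \<and>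
      aff_dim (multicut_polytope Vbar Ebar S) \<le> aff_dim Z + 1"
  proof (cases "f \<in> S")
    case False
    then have "aff_dim (multicut_polytope Vbar Ebar S) \<le> aff_dim ?Y + 1"
      using dim dim_Y dim_Qbar by simp
    then show ?thesis
      by (intro exI[of _ ?Y] conjI ballI insert_not_empty Y lbar_Y)
  next
    case True
    \<comment> \<open>Both halves have value 1 at \<open>?z\<close>, while at every point of
      \<open>?Y\<close> the two values sum to 1.\<close>
    let ?z = "raise_coord f\<^sub>1 (swap_coord f f\<^sub>2 x)"
    have a_f: "a $ f = 0" by (rule shared_facet_coeff_zero[OF dom poly True])
    have one: "y $ f = 1" if "y \<in> ?Q" for y
      by (rule multicut_polytope_fixed_coord[OF S f_in_E True that])
    have zero: "y $ f\<^sub>1 = 0" "y $ f\<^sub>2 = 0" if "y \<in> ?Q" for y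
      using Q_sub[OF that] by (auto simp: coord_space_def)
    have "swap_coord f f\<^sub>2 x $ f\<^sub>1 + swap_coord f f\<^sub>2 x $ f\<^sub>2 = 1"
      using one[OF x(1)] zero[OF x(1)] Q_sub[OF x(1)] by (simp add: swap_coord_nth')
    moreover have "swap_coord f f\<^sub>1 y $ f\<^sub>1 + swap_coord f f\<^sub>1 y $ f\<^sub>2 = 1" if "y \<in> ?Q" for y
      using one[OF that] zero[OF that] Q_sub[OF that] by (simp add: swap_coord_nth)
    ultimately have "?Y \<subseteq> {y. y $ f\<^sub>1 + y $ f\<^sub>2 = 1}" by blast
    moreover have "affine {y :: real ^ ('v set). y $ f\<^sub>1 + y $ f\<^sub>2 = 1}"
      using affine_hyperplane[of "axis f\<^sub>1 1 + axis f\<^sub>2 1 :: real ^ ('v set)" 1]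
      by (simp add: inner_add_left inner_axis')
    ultimately have "affine hull ?Y \<subseteq> {y. y $ f\<^sub>1 + y $ f\<^sub>2 = 1}" by (rule hull_minimal)
    moreover have "?z $ f\<^sub>1 + ?z $ f\<^sub>2 = 2"
      using one[OF x(1)] Q_sub[OF x(1)] by (simp add: raise_coord_def swap_coord_nth')
    ultimately have "?z \<notin> affine hull ?Y" by auto
    then have dim_Z: "aff_dim (insert ?z ?Y) = aff_dim ?F + 2"
      using dim_Y by (simp add: aff_dim_insert)
    have "?z \<in> multicut_polytope Vbar Ebar S"
      using Y by (intro raise_coord_multicut_polytope[OF Sbar]) auto
    moreover have "?z $ e = swap_coord f f\<^sub>2 x $ e" if "e \<in> E" for e
    proof -
      have "e \<noteq> f\<^sub>1" using that new_edges(1) by metis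
      then show ?thesis by (simp add: raise_coord_def)
    qed
    \<comment> \<open>Only coordinate \<open>f\<^sub>1\<close> was changed, and its coefficient is
      \<open>a $ f = 0\<close>.\<close>
    then have "lbar ?z = lbar (swap_coord f f\<^sub>2 x)" using a_f by simp
    moreover have "aff_dim (multicut_polytope Vbar Ebar S) \<le> aff_dim (insert ?z ?Y) + 1"
      using dim dim_Z dim_Qbar True by simp
    ultimately show ?thesis using Y lbar_Y
      by (intro exI[of _ "insert ?z ?Y"] conjI ballI insert_not_empty insert_subsetI) auto
  qed
  then obtain Z where Z: "Z \<noteq> {}" "Z \<subseteq> multicut_polytope Vbar Ebar S" "\<And>y. y \<in> Z \<Longrightarrow> lbar y = b"
    "aff_dim (multicut_polytope Vbar Ebar S) \<le> aff_dim Z + 1" by blast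
  show ?thesis
  proof (rule facet_definingI[OF linear_lbar convex])
    show "b \<le> lbar y" if "y \<in> multicut_polytope Vbar Ebar S" for y
      by (rule lbar_valid_polytope[OF dominant_facet_nonneg[OF dom] valid that])
    show "swap_coord f f\<^sub>1 p \<in> multicut_polytope Vbar Ebar S" by (rule swap_coord_polytope[OF p(1)])
    show "lbar (swap_coord f f\<^sub>1 p) \<noteq> b" using p Q_sub lbar_swap_coord by simp
  qed (use Z in auto)
qed

end

end

text \<open>The hypothesis \<open>not_nonneg_f\<close> excludes positive multiples of
  \<open>x $ f \<ge> 0\<close>. Their lifts are tight on the dominant only where both halves vanish,
  a face of codimension at least two.\<close>

theorem theorem4p3:
  fixes V Vbar :: "'v::finite set" and E S Ebar :: "'v set set"
    and a :: "real ^ ('v set)" and b :: real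
    and f f\<^sub>1 f\<^sub>2 :: "'v set" and u v w :: 'v
  assumes graph: "simple_graph V E"
    and S: "S \<subseteq> node_pairs V"
    and facet: "facet_defining (multicut_dominant V E S) (\<lambda>x. \<Sum>e\<in>E. a $ e * x $ e) b"
    and f: "f \<in> E" "f = {u, v}"
    and not_nonneg_f: "\<not> (b = 0 \<and> (\<exists>c>0. \<forall>e\<in>E. a $ e = (if e = f then c else 0)))"
    and subdivision: "w \<notin> V" "f\<^sub>1 = {u, w}" "f\<^sub>2 = {w, v}"
      "Vbar = insert w V" "Ebar = (E - {f}) \<union> {f\<^sub>1, f\<^sub>2}"
  shows "facet_defining (multicut_dominant Vbar Ebar S)
           (\<lambda>x. a $ f * (x $ f\<^sub>1 + x $ f\<^sub>2) + (\<Sum>e\<in>E - {f}. a $ e * x $ e)) b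
       \<and> (shared_facet_defining V E S (\<lambda>x. \<Sum>e\<in>E. a $ e * x $ e) b \<longrightarrow>
          shared_facet_defining Vbar Ebar S
           (\<lambda>x. a $ f * (x $ f\<^sub>1 + x $ f\<^sub>2) + (\<Sum>e\<in>E - {f}. a $ e * x $ e)) b)"
proof -
  interpret edge_subdivision V E S u v w f f\<^sub>1 f\<^sub>2
    using graph S f subdivision by unfold_locales auto
  show ?thesis
    using facet_dominant[of a b] facet_polytope[of a b] facet not_nonneg_f
    unfolding shared_facet_defining_def subdivision(4,5) by blast
qed

end
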